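(* Let $\Omega\subset\mathbb R^2\setminus\{(k\pi,0):k\in\mathbb Z\}$ be a simply connected domain. (a) On $\Omega$, $$f^{\mathbb I^3}_{\mathcal S_{\mathrm{tower}}}=\sum_{k\in\mathbb Z}f^{\mathbb I^3}_{\mathcal L^{(k)}}.$$ (b) On $\Omega$, for suitable choices of continuous branches, $$f^{\mathbb I^3}_{\mathcal S_{\mathrm{surf}}}=\sum_{k\in\mathbb Z}f^{\mathbb I^3}_{\mathcal H^{(k)}}.$$
   Context: Isotropic $3$-space $\mathbb I^3$ is $\mathbb R^3$ with the degenerate metric $dx^2+dy^2$. Write $z=x+iy$. The isotropic Scherk tower and the isotropic Scherk (doubly periodic) surface are the graphs of $$f^{\mathbb I^3}_{\mathcal S_{\mathrm{tower}}}(x,y)=\operatorname{Re}[\ln(\sin z)],\qquad f^{\mathbb I^3}_{\mathcal S_{\mathrm{surf}}}(x,y)=\operatorname{Im}[\ln(\sin z)],$$ where $\ln(\sin z)$ is a holomorphic branch on $\Omega$. The dilated and translated logarithmoids of revolution are the graphs of $$f^{\mathbb I^3}_{\mathcal L^{(0)}}(x,y)=\ln\sqrt{x^2+y^2},\qquad f^{\mathbb I^3}_{\mathcal L^{(k)}}(x,y)=\ln\sqrt{\frac{(x+k\pi)^2+y^2}{k^2\pi^2}}\quad(k\ne0),$$ and the dilated isotropic helicoids are the graphs of $f^{\mathbb I^3}_{\mathcal H^{(k)}}(x,y)=\tan^{-1}\!\left(\frac{y}{x-k\pi}\right)$, $k\in\mathbb Z$, interpreted as a continuous branch on $\Omega$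 (i.e. a continuous function on $\Omega$ whose tangent is $y/(x-k\pi)$ wherever $x\neq k\pi$). Sums over $k\in\mathbb Z$ are limits of the symmetric partial sums $\sum_{|k|\le N}$ as $N\to\infty$. *)

theory Defs
  imports "HOL-Complex_Analysis.Complex_Analysis"
begin

text \<open>The isotropic space is the real 3-space with the metric \<open>dx\<^sup>2 + dy\<^sup>2\<close>; the surfaces are graphs over
  subsets of the \<open>(x, y)\<close>-plane, so each one is represented by its height function.\<close>

definition complex_of_plane :: "real \<times> real \<Rightarrow> complex" where
  "complex_of_plane = (\<lambda>(x, y). Complex x y)"

definition ln_sin_branch :: "(real \<times> real) set \<Rightarrow> (complex \<Rightarrow> complex) \<Rightarrow> bool" where
  "ln_sin_branch \<Omega> L \<longleftrightarrow>
     L holomorphic_on (complex_of_plane ` \<Omega>) \<and> (\<forall>z \<in> complex_of_plane ` \<Omega>. exp (L z) = sin z)"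

text \<open>In the next two definitions \<open>L\<close> is a holomorphic branch of \<open>ln (sin z)\<close>.\<close>

definition scherk_tower :: "(complex \<Rightarrow> complex) \<Rightarrow> real \<times> real \<Rightarrow> real" where
  "scherk_tower L p = Re (L (complex_of_plane p))"

definition scherk_surface :: "(complex \<Rightarrow> complex) \<Rightarrow> real \<times> real \<Rightarrow> real" where
  "scherk_surface L p = Im (L (complex_of_plane p))"

definition logarithmoid :: "int \<Rightarrow> real \<times> real \<Rightarrow> real" where
  "logarithmoid k = (\<lambda>(x, y).
     if k = 0 then ln (sqrt (x\<^sup>2 + y\<^sup>2))
     else ln (sqrt (((x + of_int k * pi)\<^sup>2 + y\<^sup>2) / ((of_int k)\<^sup>2 * pi\<^sup>2))))"

text \<open>A continuous branch of \<open>arctan (y / (x - k \<pi>))\<close>. The condition \<open>cos (h (x, y)) \<noteq> 0\<close> says that the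
  tangent is defined; without it, the convention \<open>tan (\<pi> / 2) = 0\<close> would interfere where \<open>y = 0\<close>.
  On the line \<open>x = k \<pi>\<close> the values are determined by continuity.\<close>

definition helicoid_branch :: "(real \<times> real) set \<Rightarrow> int \<Rightarrow> (real \<times> real \<Rightarrow> real) \<Rightarrow> bool" where
  "helicoid_branch \<Omega> k h \<longleftrightarrow>
     continuous_on \<Omega> h \<and>
     (\<forall>(x, y) \<in> \<Omega>. x \<noteq> of_int k * pi \<longrightarrow>
        cos (h (x, y)) \<noteq> 0 \<and> tan (h (x, y)) = y / (x - of_int k * pi))"

definition has_symmetric_sum :: "(int \<Rightarrow> real) \<Rightarrow> real \<Rightarrow> bool" where
  "has_symmetric_sum f s \<longleftrightarrow> (\<lambda>N::nat. \<Sum>k\<in>{- int N..int N}. f k) \<longlonglongrightarrow> s"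

end

theory Submission
  imports Defs
begin

text \<open>Both statements come from Euler's product for the sine. Let \<open>P N\<close> be its partial product, whose
  zeros are \<open>k\<pi>\<close> with \<open>\<bar>k\<bar> \<le> N\<close>. For (a), the symmetric partial sum of the logarithmoids is
  \<open>ln \<bar>P N z\<bar>\<close>. For (b), fix a base point and let \<open>T N\<close> be the branch of \<open>ln (P N)\<close> whose
  difference from \<open>L\<close> is the principal logarithm of \<open>P N / sin\<close> there. Convergence of \<open>P N\<close> to \<open>sin\<close> is
  uniform on paths, so the difference is the principal logarithm at the other end of the path as
  well, once \<open>N\<close> is large, and hence tends to \<open>0\<close>. Taking branches of \<open>ln (z - k\<pi>)\<close>
  for \<open>k > 0\<close>, and for \<open>k < 0\<close> whatever makes the sums telescope to \<open>T N\<close>, gives the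
  helicoids.\<close>

section \<open>Euler's product for the sine: zeros and locally uniform convergence\<close>

definition sine_product :: "nat \<Rightarrow> complex \<Rightarrow> complex" where
  "sine_product N z = z * (\<Prod>k=1..N. 1 - z\<^sup>2 / (of_nat k * of_real pi)\<^sup>2)"

lemma sine_product_0 [simp]: "sine_product 0 z = z"
  by (simp add: sine_product_def)

lemma sine_product_Suc:
  "sine_product (Suc N) z = sine_product N z * (1 - z\<^sup>2 / (of_nat (Suc N) * of_real pi)\<^sup>2)"
  by (simp add: sine_product_def)

lemma holomorphic_sine_product: "sine_product N holomorphic_on A"
  unfolding sine_product_def by (intro holomorphic_intros) auto

lemma tendsto_sine_product: "(\<lambda>N. sine_product N z) \<longlonglongrightarrow> sin z"
proof -
  \<comment> \<open>Euler's formula is stated for \<open>sin (pi * w)\<close>; it is applied at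
    \<open>w = z / pi\<close>, which turns \<open>w\<^sup>2 / k\<^sup>2\<close> into the quotient in
    \<open>sine_product\<close>.\<close>
  have "sine_product N z =
      of_real pi * (z / of_real pi) * (\<Prod>k=1..N. 1 - (z / of_real pi)\<^sup>2 / of_nat k ^ 2)" for N
    by (simp add: sine_product_def power_divide power_mult_distrib mult.commute)
  with sin_product_formula_complex[of "z / of_real pi"] show ?thesis by simp
qed

text \<open>Separates the linear terms of the two opposite zeros. Non-vanishing, the pairing of the
  indices \<open>k\<close> and \<open>- k\<close>, and the negative constant met in the helicoids of
  negative index all come from this form.\<close>

lemma sine_factor_eq:
  fixes z :: complex
  assumes "k \<noteq> 0"
  shows "1 - z\<^sup>2 / (of_nat k * of_real pi)\<^sup>2 =
    - ((z - of_nat k * of_real pi) * (z + of_nat k * of_real pi)) / (of_nat k * of_real pi)\<^sup>2"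
  using assms by (simp add: field_simps power2_eq_square)

lemma sine_product_nonzero:
  assumes "\<And>k::int. z \<noteq> of_int k * of_real pi"
  shows "sine_product N z \<noteq> 0"
proof (induction N)
  case 0
  show ?case using assms[of 0] by simp
next
  case (Suc N)
  have "z - of_nat (Suc N) * of_real pi \<noteq> 0" using assms[of "int (Suc N)"] by simp
  moreover have "z + of_nat (Suc N) * of_real pi \<noteq> 0"
    using assms[of "- int (Suc N)"] by (simp add: add_eq_0_iff2 del: of_nat_Suc)
  ultimately show ?case
    unfolding sine_product_Suc sine_factor_eq[OF nat.simps(3)] using Suc
    by (simp del: of_nat_Suc)
qed

text \<open>On a bounded set the k-th factor differs from 1 by at most a constant times
  \<open>1 / k\<^sup>2\<close>, so the M-test makes the product converge uniformly. The pointwise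
  Euler formula then identifies the limit.\<close>

lemma uniform_limit_sine_product:
  assumes "compact K"
  shows "uniform_limit K sine_product sin sequentially"
proof -
  obtain R where R: "\<And>z. z \<in> K \<Longrightarrow> norm z \<le> R"
    using compact_imp_bounded[OF assms] by (auto simp: bounded_iff)
  define f where "f = (\<lambda>k (z::complex). 1 - z\<^sup>2 / (of_nat (Suc k) * of_real pi)\<^sup>2)"
  have "uniformly_convergent_on K (\<lambda>N z. \<Prod>k<N. f k z)"
  proof (rule uniformly_convergent_on_prod')
    show "continuous_on K (f k)" for k
      unfolding f_def by (intro continuous_intros) (auto simp del: of_nat_Suc)
    show "uniformly_convergent_on K (\<lambda>N z. \<Sum>k<N. norm (f k z - 1))"
    proof (rule Weierstrass_m_test')
      show "norm (norm (f k z - 1)) \<le> R\<^sup>2 / pi\<^sup>2 * (1 / real (Suc k) ^ 2)" if "z \<in> K" for k z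
      proof -
        have "norm (norm (f k z - 1)) = (norm z)\<^sup>2 / (real (Suc k) * pi)\<^sup>2"
          by (simp add: f_def norm_divide norm_power norm_mult del: of_nat_Suc)
        also have "\<dots> \<le> R\<^sup>2 / (real (Suc k) * pi)\<^sup>2"
          using R[OF that] by (intro divide_right_mono power_mono) auto
        finally show ?thesis by (simp add: power_mult_distrib mult.commute del: of_nat_Suc)
      qed
      show "summable (\<lambda>k. R\<^sup>2 / pi\<^sup>2 * (1 / real (Suc k) ^ 2))"
        using inverse_power_summable[of 2, where 'a = real]
          summable_Suc_iff[of "\<lambda>k. 1 / real k ^ 2"]
        by (intro summable_mult) (simp add: inverse_eq_divide del: of_nat_Suc)
    qed
  qed (use assms in auto)
  then obtain l where l: "uniform_limit K (\<lambda>N z. \<Prod>k<N. f k z) l sequentially"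
    by (auto simp: uniformly_convergent_on_def)
  have prod: "z * (\<Prod>k<N. f k z) = sine_product N z" for N z
    by (induction N) (simp_all add: sine_product_Suc f_def mult.assoc[symmetric] del: of_nat_Suc)
  \<comment> \<open>Multiplying two uniform limits requires both limit functions to be bounded; for
    \<open>l\<close> this follows from continuity on the compact set.\<close>
  have "continuous_on K l"
    using l by (rule uniform_limit_theorem[rotated])
      (auto simp: f_def simp del: of_nat_Suc intro!: always_eventually continuous_intros)
  then have "bounded (l ` K)"
    using assms by (intro compact_imp_bounded compact_continuous_image)
  then have "uniform_limit K (\<lambda>N z. z * (\<Prod>k<N. f k z)) (\<lambda>z. z * l z) sequentially"
    using l compact_imp_bounded[OF assms]
    by (intro uniform_lim_mult uniform_limit_const) auto
  then have lim: "uniform_limit K sine_product (\<lambda>z. z * l z) sequentially"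
    by (simp add: prod)
  have "z * l z = sin z" if "z \<in> K" for z
    using tendsto_uniform_limitI[OF lim that] tendsto_sine_product LIMSEQ_unique by blast
  with lim show ?thesis by (metis (no_types, lifting) uniform_limit_cong')
qed

section \<open>Continuous logarithms on connected sets\<close>

lemma continuous_log_one_constant:
  fixes g :: "'a::topological_space \<Rightarrow> complex"
  assumes "connected K" "continuous_on K g" and exp: "\<And>z. z \<in> K \<Longrightarrow> exp (g z) = 1"
  shows "g constant_on K"
proof (rule continuous_discrete_range_constant[OF assms(1,2)])
  fix x assume x: "x \<in> K"
  \<comment> \<open>Logarithms of 1 are integer multiples of \<open>2 * pi * \<i>\<close>, so
    distinct values of \<open>g\<close> are at least \<open>2 * pi\<close> apart.\<close>
  have "2 * pi \<le> norm (g y - g x)" if y: "y \<in> K" "g y \<noteq> g x" for y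
  proof -
    from x y exp have "exp (g y) = exp (g x)" by simp
    then obtain n :: int where n: "g y = g x + of_int (2 * n) * of_real pi * \<i>"
      by (auto simp: exp_eq)
    with y have "n \<noteq> 0" by auto
    then have "1 \<le> \<bar>real_of_int n\<bar>" by linarith
    with n show ?thesis by (simp add: norm_mult)
  qed
  then show "\<exists>e>0. \<forall>y. y \<in> K \<and> g y \<noteq> g x \<longrightarrow> e \<le> norm (g y - g x)"
    by (intro exI[of _ "2 * pi"]) auto
qed

text \<open>Once \<open>exp (E N w)\<close> is within distance 1 of 1 on all of \<open>K\<close>, it
  stays in the right half-plane, where \<open>Ln\<close> is continuous. So \<open>E N\<close> and
  \<open>Ln (exp (E N w))\<close> differ by a constant on \<open>K\<close>, which
  \<open>base\<close> forces to be 0 by looking at \<open>a\<close>. Continuity of \<open>Ln\<close>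
  at 1 finishes.\<close>

lemma tendsto_log_of_uniform_limit_one:
  fixes E :: "nat \<Rightarrow> 'a::topological_space \<Rightarrow> complex"
  assumes "connected K" "a \<in> K" "z \<in> K"
    and cont: "\<And>N. continuous_on K (E N)"
    and lim: "uniform_limit K (\<lambda>N z. exp (E N z)) (\<lambda>_. 1) sequentially"
    and base: "\<And>N. E N a = Ln (exp (E N a))"
  shows "(\<lambda>N. E N z) \<longlonglongrightarrow> 0"
proof -
  have "\<forall>\<^sub>F N in sequentially. \<forall>w\<in>K. dist (exp (E N w)) 1 < 1"
    using lim by (rule uniform_limitD) simp
  then have "\<forall>\<^sub>F N in sequentially. Ln (exp (E N z)) = E N z"
  proof eventually_elim
    case (elim N)
    have pos: "exp (E N w) \<notin> \<real>\<^sub>\<le>\<^sub>0" if "w \<in> K" for w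
    proof -
      have "\<bar>Re (exp (E N w) - 1)\<bar> < 1"
        using elim that abs_Re_le_cmod[of "exp (E N w) - 1"] by (fastforce simp: dist_norm)
      then have "Re (exp (E N w)) > 0" by simp
      then show ?thesis by (auto simp: complex_nonpos_Reals_iff)
    qed
    have "(\<lambda>w. E N w - Ln (exp (E N w))) constant_on K"
      using assms(1) pos
      by (intro continuous_log_one_constant continuous_intros cont) (auto simp: exp_diff)
    then obtain c where "\<And>w. w \<in> K \<Longrightarrow> E N w - Ln (exp (E N w)) = c"
      by (auto simp: constant_on_def)
    from this[OF assms(2)] this[OF assms(3)] base[of N] show ?case by simp
  qed
  moreover have "(\<lambda>N. Ln (exp (E N z))) \<longlonglongrightarrow> Ln 1"
    by (rule tendsto_Ln[OF tendsto_uniform_limitI[OF lim assms(3)]]) auto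
  ultimately show ?thesis by (simp add: tendsto_cong)
qed

lemma uniform_limit_sine_product_ratio:
  assumes "compact K" and nz: "\<And>z. z \<in> K \<Longrightarrow> sin z \<noteq> (0::complex)"
  shows "uniform_limit K (\<lambda>N z. sine_product N z / sin z) (\<lambda>_. 1) sequentially"
proof (cases "K = {}")
  case False
  \<comment> \<open>The minimum of the modulus of \<open>sin\<close> on \<open>K\<close> is the
    positive lower bound on the denominator that a uniform quotient limit requires.\<close>
  obtain w where "w \<in> K" and w: "\<And>z. z \<in> K \<Longrightarrow> norm (sin w) \<le> norm (sin z)"
    using continuous_attains_inf[OF assms(1) False, of "\<lambda>z. norm (sin z)"]
      continuous_on_norm[OF continuous_on_sin[OF continuous_on_id]]
    by blast
  have bnd: "bounded (sin ` K)"
    using assms(1) by (intro compact_imp_bounded compact_continuous_image continuous_intros)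
  have "uniform_limit K (\<lambda>N z. sine_product N z / sin z) (\<lambda>z. sin z / sin z) sequentially"
    by (rule uniform_lim_divide[OF uniform_limit_sine_product[OF assms(1)] uniform_limit_const bnd w])
      (use nz \<open>w \<in> K\<close> in auto)
  then show ?thesis by (rule uniform_limit_cong'[THEN iffD1, rotated -1]) (use nz in auto)
qed simp

section \<open>Symmetric sums and the Scherk tower\<close>

lemma sum_symmetric_int:
  fixes f :: "int \<Rightarrow> 'a::comm_monoid_add"
  shows "(\<Sum>k\<in>{- int N..int N}. f k) = f 0 + (\<Sum>k=1..N. f (int k) + f (- int k))"
proof (induction N)
  case (Suc N)
  have "{- int (Suc N)..int (Suc N)} =
      insert (int (Suc N)) (insert (- int (Suc N)) {- int N..int N})"
    by auto
  with Suc show ?case by (simp add: ac_simps)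
qed simp

lemma has_symmetric_sum_logarithmoid:
  assumes L: "exp l = sin (complex_of_plane p)"
  shows "has_symmetric_sum (\<lambda>k. logarithmoid k p) (Re l)"
proof -
  obtain x y where p: "p = (x, y)" by (cases p)
  define z where "z = complex_of_plane p"
  have z: "z = Complex x y" by (simp add: z_def p complex_of_plane_def)
  have "sin z \<noteq> 0" using L exp_not_eq_zero z_def by metis
  then have nz: "z \<noteq> of_int k * of_real pi" for k :: int by (auto simp: sin_eq_0)
  have log0: "logarithmoid 0 p = ln (norm z)"
    by (simp add: logarithmoid_def p z complex_norm)
  have log: "logarithmoid k p = ln (norm (z + of_int k * of_real pi) / (\<bar>of_int k\<bar> * pi))" if "k \<noteq> 0" for k
    using that by (simp add: logarithmoid_def p z cmod_def real_sqrt_divide real_sqrt_mult)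
  \<comment> \<open>The two moduli are those of the linear terms at \<open>- k * pi\<close> and
    \<open>k * pi\<close>, and their normalisations multiply to \<open>(k * pi)\<^sup>2\<close>, so
    together they give the k-th Euler factor.\<close>
  have pair: "logarithmoid (int k) p + logarithmoid (- int k) p =
      ln (norm (1 - z\<^sup>2 / (of_nat k * of_real pi)\<^sup>2))" if "k > 0" for k
  proof -
    have "z + of_nat k * of_real pi \<noteq> 0" "z - of_nat k * of_real pi \<noteq> 0"
      using nz[of "- int k"] nz[of "int k"] by (auto simp: add_eq_0_iff2)
    with that show ?thesis
      unfolding sine_factor_eq[OF gr_implies_not0[OF that]]
      by (simp add: log norm_mult norm_divide norm_power ln_div ln_mult ln_realpow)
  qed
  have prod: "ln (norm (sine_product N z)) =
      ln (norm z) + (\<Sum>k=1..N. ln (norm (1 - z\<^sup>2 / (of_nat k * of_real pi)\<^sup>2)))" for N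
  proof (induction N)
    case (Suc N)
    have "sine_product N z \<noteq> 0" "sine_product (Suc N) z \<noteq> 0"
      using sine_product_nonzero nz by blast+
    then have "ln (norm (sine_product (Suc N) z)) =
        ln (norm (sine_product N z)) + ln (norm (1 - z\<^sup>2 / (of_nat (Suc N) * of_real pi)\<^sup>2))"
      by (simp add: sine_product_Suc norm_mult ln_mult del: of_nat_Suc)
    with Suc show ?case by simp
  qed simp
  have "(\<Sum>k\<in>{- int N..int N}. logarithmoid k p) = ln (norm (sine_product N z))" for N
    unfolding sum_symmetric_int log0 prod using pair by (auto intro!: sum.cong)
  moreover have "(\<lambda>N. ln (norm (sine_product N z))) \<longlonglongrightarrow> ln (norm (sin z))"
    using \<open>sin z \<noteq> 0\<close> by (intro tendsto_ln tendsto_norm tendsto_sine_product) auto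
  moreover have "ln (norm (sin z)) = Re l"
    unfolding z_def L[symmetric] by simp
  ultimately show ?thesis by (simp add: has_symmetric_sum_def)
qed

section \<open>Transfer between the real plane and the complex numbers; helicoids as
  arguments\<close>

lemma homeomorphism_complex_of_plane:
  "homeomorphism \<Omega> (complex_of_plane ` \<Omega>) complex_of_plane (\<lambda>z. (Re z, Im z))"
proof -
  have "continuous_on A (\<lambda>q. of_real (fst q) + \<i> * of_real (snd q))" for A :: "(real \<times> real) set"
    by (intro continuous_intros)
  then have "continuous_on A complex_of_plane" for A
    by (simp add: complex_of_plane_def case_prod_unfold Complex_eq)
  then show ?thesis
    by (auto simp: homeomorphism_def complex_of_plane_def intro!: continuous_intros image_eqI)
qed

lemma open_complex_of_plane_image:
  assumes "open \<Omega>"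
  shows "open (complex_of_plane ` \<Omega>)"
proof -
  have "complex_of_plane ` \<Omega> = (\<lambda>z. (Re z, Im z)) -` \<Omega>"
    by (force simp: complex_of_plane_def)
  then show ?thesis using assms by (auto intro!: open_vimage continuous_intros)
qed

lemma simply_connected_complex_of_plane_image:
  "simply_connected \<Omega> \<Longrightarrow> simply_connected (complex_of_plane ` \<Omega>)"
  using homeomorphism_complex_of_plane homeomorphic_def homeomorphic_simply_connected by blast

text \<open>The tangent of an argument is the quotient of imaginary and real part, from which a real
  factor \<open>c\<close> cancels whatever its sign. Allowing \<open>c\<close> lets logarithms of
  constant multiples of \<open>z - k * pi\<close> serve as branches too.\<close>

lemma helicoid_branch_Im_log:
  assumes cont: "continuous_on (complex_of_plane ` \<Omega>) g" and "c \<noteq> 0"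
    and exp: "\<And>z. z \<in> complex_of_plane ` \<Omega> \<Longrightarrow> exp (g z) = of_real c * (z - of_int k * of_real pi)"
  shows "helicoid_branch \<Omega> k (\<lambda>p. Im (g (complex_of_plane p)))"
  unfolding helicoid_branch_def
proof (intro conjI ballI, safe)
  show "continuous_on \<Omega> (\<lambda>p. Im (g (complex_of_plane p)))"
    using homeomorphism_complex_of_plane[of \<Omega>]
    by (intro continuous_on_Im continuous_on_compose2[OF cont]) (auto simp: homeomorphism_def)
  fix x y assume xy: "(x, y) \<in> \<Omega>" and "x \<noteq> of_int k * pi"
  define w where "w = g (complex_of_plane (x, y))"
  have w: "exp w = of_real c * (Complex x y - of_int k * of_real pi)"
    using exp[OF imageI[OF xy]] by (simp add: w_def complex_of_plane_def)
  have re: "exp (Re w) * cos (Im w) = c * (x - of_int k * pi)"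
    using arg_cong[OF w, of Re] by (simp add: Re_exp)
  have im: "exp (Re w) * sin (Im w) = c * y"
    using arg_cong[OF w, of Im] by (simp add: Im_exp)
  have nz: "cos (Im w) \<noteq> 0" using re \<open>c \<noteq> 0\<close> \<open>x \<noteq> of_int k * pi\<close> by auto
  have "tan (Im w) = (exp (Re w) * sin (Im w)) / (exp (Re w) * cos (Im w))"
    by (simp add: tan_def)
  also have "\<dots> = y / (x - of_int k * pi)" unfolding re im using \<open>c \<noteq> 0\<close> by simp
  finally show "tan (Im (g (complex_of_plane (x, y)))) = y / (x - of_int k * pi)"
    by (simp add: w_def)
  show "cos (Im (g (complex_of_plane (x, y)))) = 0 \<Longrightarrow> False" using nz by (simp add: w_def)
qed

lemma tendsto_log_sine_product:
  assumes "open D" "connected D" "a \<in> D" "z \<in> D"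
    and contL: "continuous_on D L" and L: "\<And>z. z \<in> D \<Longrightarrow> exp (L z) = sin z"
    and contT: "\<And>N. continuous_on D (T N)" and T: "\<And>N z. z \<in> D \<Longrightarrow> exp (T N z) = sine_product N z"
    and base: "\<And>N. T N a - L a = Ln (sine_product N a / sin a)"
  shows "(\<lambda>N. T N z) \<longlonglongrightarrow> L z"
proof -
  \<comment> \<open>A path from \<open>a\<close> to \<open>z\<close> is a compact connected set
    containing both points: compactness gives the uniform limit, connectedness carries the
    normalisation from \<open>a\<close> to \<open>z\<close>.\<close>
  have "path_connected D" using assms(1,2) by (simp add: connected_open_path_connected)
  then obtain g where g: "path g" "path_image g \<subseteq> D" "pathstart g = a" "pathfinish g = z"
    using assms(3,4) unfolding path_connected_def by blast
  let ?K = "path_image g"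
  have K: "a \<in> ?K" "z \<in> ?K" using g pathstart_in_path_image pathfinish_in_path_image by metis+
  have nz: "sin w \<noteq> 0" if "w \<in> D" for w using L[OF that] exp_not_eq_zero by metis
  have ratio: "exp (T N w - L w) = sine_product N w / sin w" if "w \<in> D" for N w
    using that by (simp add: exp_diff L T)
  have "(\<lambda>N. T N z - L z) \<longlonglongrightarrow> 0"
  proof (rule tendsto_log_of_uniform_limit_one[OF connected_path_image[OF g(1)] K])
    show "continuous_on ?K (\<lambda>z. T N z - L z)" for N
      using g(2) contL contT by (intro continuous_intros) (auto intro: continuous_on_subset)
    show "uniform_limit ?K (\<lambda>N z. exp (T N z - L z)) (\<lambda>_. 1) sequentially"
      by (rule uniform_limit_cong'[THEN iffD1,
            OF _ _ uniform_limit_sine_product_ratio[OF compact_path_image[OF g(1)]]])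
        (use g(2) nz ratio in auto)
    show "T N a - L a = Ln (exp (T N a - L a))" for N
      using base ratio[OF assms(3)] by simp
  qed
  then show ?thesis by (simp add: LIM_zero_iff)
qed

section \<open>Choice of the branches on the domain\<close>

theorem proposition2p7:
  fixes \<Omega> :: "(real \<times> real) set"
  assumes "\<Omega> \<noteq> {}" and "open \<Omega>" and "connected \<Omega>" and "simply_connected \<Omega>"
    and "\<Omega> \<subseteq> UNIV - {(of_int k * pi, 0) | k :: int. True}"
  shows "(\<exists>L. ln_sin_branch \<Omega> L) \<and>
    (\<forall>L. ln_sin_branch \<Omega> L \<longrightarrow>
      (\<forall>p\<in>\<Omega>. has_symmetric_sum (\<lambda>k. logarithmoid k p) (scherk_tower L p)) \<and>
      (\<exists>H :: int \<Rightarrow> real \<times> real \<Rightarrow> real.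
        (\<forall>k. helicoid_branch \<Omega> k (H k)) \<and>
        (\<forall>p\<in>\<Omega>. has_symmetric_sum (\<lambda>k. H k p) (scherk_surface L p))))"
proof -
  define D where "D = complex_of_plane ` \<Omega>"
  have oD: "open D" and scD: "simply_connected D"
    using open_complex_of_plane_image simply_connected_complex_of_plane_image assms
    by (auto simp: D_def)
  have nz: "z \<noteq> of_int k * of_real pi" if "z \<in> D" for z and k :: int
    using that assms(5) by (fastforce simp: D_def complex_of_plane_def complex_eq_iff)
  then have sin_nz: "sin z \<noteq> 0" if "z \<in> D" for z using that by (auto simp: sin_eq_0)
  \<comment> \<open>Simple connectedness supplies logarithms of non-vanishing holomorphic functions;
    this is applied to \<open>sin\<close>, to the partial products and to each
    \<open>z - k * pi\<close>.\<close>
  have log: "\<exists>g. g holomorphic_on D \<and> (\<forall>z\<in>D. f z = exp (g z))"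
    if "f holomorphic_on D" "\<And>z. z \<in> D \<Longrightarrow> f z \<noteq> 0" for f
    using that scD simply_connected_eq_holomorphic_log[OF oD] by blast
  have ex: "\<exists>L. ln_sin_branch \<Omega> L"
    using log[of sin] sin_nz by (auto simp: ln_sin_branch_def holomorphic_on_sin simp flip: D_def)
  obtain a where a: "a \<in> D" using assms(1) by (auto simp: D_def)

  have surf: "\<exists>H :: int \<Rightarrow> real \<times> real \<Rightarrow> real. (\<forall>k. helicoid_branch \<Omega> k (H k)) \<and>
      (\<forall>p\<in>\<Omega>. has_symmetric_sum (\<lambda>k. H k p) (scherk_surface L p))" if "ln_sin_branch \<Omega> L" for L
  proof -
    have holL: "L holomorphic_on D" and L: "\<And>z. z \<in> D \<Longrightarrow> exp (L z) = sin z"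
      using that by (auto simp: ln_sin_branch_def D_def)
    have "\<exists>T. continuous_on D T \<and> (\<forall>z\<in>D. exp (T z) = sine_product N z) \<and>
        T a - L a = Ln (sine_product N a / sin a)" for N
    proof -
      have P: "sine_product N z \<noteq> 0" if "z \<in> D" for z
        using nz[OF that] sine_product_nonzero by blast
      then obtain g where g: "g holomorphic_on D" "\<And>z. z \<in> D \<Longrightarrow> exp (g z) = sine_product N z"
        using log[OF holomorphic_sine_product] by metis
      show ?thesis
      proof (intro exI conjI ballI)
        \<comment> \<open>The added constant has exponential 1, since \<open>exp (g a)\<close> is
          the partial product at \<open>a\<close> and \<open>exp (L a) = sin a\<close>. It only
          moves the value at \<open>a\<close> to the one prescribed by \<open>base\<close>.\<close>
        let ?T = "\<lambda>z. g z - g a + L a + Ln (sine_product N a / sin a)"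
        show "continuous_on D ?T"
          by (intro continuous_intros holomorphic_on_imp_continuous_on g)
        show "exp (?T z) = sine_product N z" if "z \<in> D" for z
          using that a P[OF a] sin_nz[OF a] by (simp add: exp_add exp_diff g(2) L)
      qed simp
    qed
    then obtain T where contT: "\<And>N. continuous_on D (T N)"
      and T: "\<And>N z. z \<in> D \<Longrightarrow> exp (T N z) = sine_product N z"
      and base: "\<And>N. T N a - L a = Ln (sine_product N a / sin a)"
      by metis
    have "\<exists>g. g holomorphic_on D \<and> (\<forall>z\<in>D. z - of_int k * of_real pi = exp (g z))" for k
      using nz by (intro log holomorphic_intros) auto
    then obtain G where holG: "\<And>k. G k holomorphic_on D"
      and G: "\<And>k z. z \<in> D \<Longrightarrow> exp (G k z) = z - of_int k * of_real pi"
      by metis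
    have contG: "continuous_on D (G k)" for k
      using holG holomorphic_on_imp_continuous_on by blast
    \<comment> \<open>The entry at \<open>- n\<close> is chosen so that
      \<open>h n + h (- n) = T n - T (n - 1)\<close> for \<open>n > 0\<close>; with
      \<open>h 0 = T 0\<close> the symmetric sums telescope.\<close>
    define h where "h k = (if k = 0 then T 0 else if k > 0 then G k
      else (\<lambda>z. T (nat (- k)) z - T (nat (- k) - 1) z - G (- k) z))" for k :: int
    have branch: "helicoid_branch \<Omega> k (\<lambda>p. Im (h k (complex_of_plane p)))" for k
    proof -
      consider "k = 0" | "k > 0" | "k < 0" by linarith
      then obtain c where "c \<noteq> 0"
        and "continuous_on D (h k) \<and>
          (\<forall>z\<in>D. exp (h k z) = of_real c * (z - of_int k * of_real pi))"
      proof cases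
        case 1
        with that[of 1] show ?thesis by (simp add: h_def contT T)
      next
        case 2
        with that[of 1] show ?thesis by (simp add: h_def contG G)
      next
        case 3
        define n where "n = nat (- k) - 1"
        with 3 have k: "k = - int (Suc n)" by simp
        have h: "h k = (\<lambda>z. T (Suc n) z - T n z - G (int (Suc n)) z)"
          by (simp add: h_def k nat_add_distrib add.commute)
        show ?thesis
        proof (rule that[OF _ conjI[OF _ ballI]])
          show "continuous_on D (h k)" unfolding h by (intro continuous_intros contT contG)
          \<comment> \<open>The quotient of consecutive partial products is the Euler factor of
            index \<open>Suc n\<close>. Dividing it by \<open>z - Suc n * pi\<close> leaves
            \<open>z + Suc n * pi\<close>, which is \<open>z - k * pi\<close>, times this
            constant.\<close>
          show "exp (h k z) = of_real (- 1 / (real (Suc n) * pi)\<^sup>2) * (z - of_int k * of_real pi)"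
            if "z \<in> D" for z
          proof -
            have "sine_product n z \<noteq> 0" using T[OF that] exp_not_eq_zero by metis
            moreover have "z - of_nat (Suc n) * of_real pi \<noteq> 0" using nz[OF that, of "int (Suc n)"] by simp
            ultimately show ?thesis
              unfolding h by (simp add: exp_diff T that G sine_product_Suc sine_factor_eq k del: of_nat_Suc)
          qed
        qed (auto simp del: of_nat_Suc)
      qed
      then show ?thesis by (intro helicoid_branch_Im_log) (auto simp: D_def)
    qed
    have sum: "(\<Sum>k\<in>{- int N..int N}. h k z) = T N z" for N z
      unfolding sum_symmetric_int
    proof (induction N)
      case (Suc N)
      then show ?case by (simp add: h_def nat_add_distrib algebra_simps)
    qed (simp add: h_def)
    have "has_symmetric_sum (\<lambda>k. Im (h k (complex_of_plane p))) (scherk_surface L p)"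
      if "p \<in> \<Omega>" for p
    proof -
      have "(\<lambda>N. T N (complex_of_plane p)) \<longlonglongrightarrow> L (complex_of_plane p)"
        using oD simply_connected_imp_connected[OF scD] a _ holomorphic_on_imp_continuous_on[OF holL]
          L contT T base
        by (rule tendsto_log_sine_product) (use that D_def in auto)
      from tendsto_Im[OF this] show ?thesis
        unfolding has_symmetric_sum_def scherk_surface_def by (simp flip: Im_sum add: sum)
    qed
    with branch show ?thesis by (intro exI[of _ "\<lambda>k p. Im (h k (complex_of_plane p))"]) auto
  qed
  have "has_symmetric_sum (\<lambda>k. logarithmoid k p) (scherk_tower L p)"
    if "ln_sin_branch \<Omega> L" "p \<in> \<Omega>" for L p
    unfolding scherk_tower_def using that
    by (intro has_symmetric_sum_logarithmoid) (auto simp: ln_sin_branch_def)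
  with ex surf show ?thesis by blast
qed

end
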